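(* The dynamic $s$-$t$-reachability query is not in unary $\mathrm{DynQF}$.
   Context: An $s$-$t$-graph is a structure over the schema with one binary relation symbol $E$ and two constants $s,t$; the $s$-$t$-reachability query is true iff there is a directed path from $s$ to $t$. Dynamic setting: schemas may contain relation, function and constant symbols. A dynamic program has a relational input schema $\tau_{in}$ and an auxiliary schema $\tau_{aux}$ that may contain relation and function symbols (no built-in data). Concrete modifications insert or delete a single tuple of an input relation (constants never modified). Update terms: every variable and constant is an update term; if $f$ is a $k$-ary function symbol and $t_1,\dots,t_k$ update terms, $f(t_1,\dots,t_k)$ is an update term; if $\phi$ is a quantifier-free formula (which may use update terms) and $t_1,t_2$ are update terms, then $\mathrm{ite}(\phi,t_1,t_2)$ is an update term, evaluating to $t_1$ if $\phi$ holds and to $t_2$ otherwise. The update program has, for every auxiliary relation symbol $R$ and abstract modification $\delta$, a quantifier-free formula $\varphi^R_\delta(\vec x;\vec y)$ (possibly using update terms), and for every auxiliary function symbol $f$ and $\delta$ an update term $t^f_\delta(\vec x;\vec y)$. After a modification $\delta(\vec a)$, the input is modified, each $R$ becomes $\{\vec b:\text{old state}\models\varphi^R_\delta(\vec a;\vec b)\}$ and each $f$ is redefined by $f(\vec b)=t^f_\delta(\vec a;\vec b)$ evaluated in the old state. A dynamic program has an arbitrary initialization mapping from input databases to auxiliary structures over the same domain and a designated query relation symbol $Q$; it maintains a query if for every input database $\mathcal D$ and every finite modification sequence $\alpha$, $Q$ after applying $\alpha$ to the initial state equals the query answer on $\alpha(\mathcal D)$. $\mathrm{DynQF}$ is the class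 of queries maintainable this way; unary $\mathrm{DynQF}$ requires all auxiliary relations and functions to have arity at most $1$. *)

theory Defs
  imports Main "HOL-Library.NList"
begin

text \<open>
  Databases are finite structures whose domain is a finite nonempty set of natural numbers; up to
  isomorphism these are all finite structures. An input schema is given by finite types
  \<^typ>\<open>'i\<close> of relation symbols and \<^typ>\<open>'c\<close> of constant symbols together with an arity
  function on \<^typ>\<open>'i\<close>. Auxiliary symbols are named by natural numbers. The set of \<open>k\<close>-tuples over
  \<open>D\<close> is \<^term>\<open>nlists k D\<close>.
\<close>

record ('i, 'c) database =
  dom :: "nat set"
  irel :: "'i \<Rightarrow> nat list set"
  const :: "'c \<Rightarrow> nat"

definition wf_database :: "('i \<Rightarrow> nat) \<Rightarrow> ('i, 'c) database \<Rightarrow> bool" where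
  "wf_database ar D \<longleftrightarrow>
     finite (dom D) \<and> dom D \<noteq> {} \<and>
     (\<forall>R. irel D R \<subseteq> nlists (ar R) (dom D)) \<and>
     (\<forall>c. const D c \<in> dom D)"

record aux_schema =
  rel_syms :: "nat set"
  fun_syms :: "nat set"
  rel_arity :: "nat \<Rightarrow> nat"
  fun_arity :: "nat \<Rightarrow> nat"

record aux_structure =
  arel :: "nat \<Rightarrow> nat list set"
  afun :: "nat \<Rightarrow> nat list \<Rightarrow> nat"

definition wf_aux_structure :: "aux_schema \<Rightarrow> nat set \<Rightarrow> aux_structure \<Rightarrow> bool" where
  "wf_aux_structure \<sigma> A X \<longleftrightarrow>
     (\<forall>R \<in> rel_syms \<sigma>. arel X R \<subseteq> nlists (rel_arity \<sigma> R) A) \<and>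
     (\<forall>f \<in> fun_syms \<sigma>. \<forall>b \<in> nlists (fun_arity \<sigma> f) A. afun X f b \<in> A)"

datatype 'i modification = Ins 'i | Del 'i

primrec mod_sym :: "'i modification \<Rightarrow> 'i" where
  "mod_sym (Ins R) = R"
| "mod_sym (Del R) = R"

text \<open>
  In an update formula or term with free variables \<open>(x; y)\<close>, \<open>XVar k\<close> refers to the
  \<open>k\<close>-th component of the modified tuple \<open>x\<close> and \<open>YVar k\<close> to the \<open>k\<close>-th component of the tuple \<open>y\<close>
  at which the auxiliary relation or function is redefined, both counted from \<open>0\<close>.
\<close>

datatype ('i, 'c) upd_term =
    XVar nat
  | YVar nat
  | Const 'c
  | App nat "('i, 'c) upd_term list"
  | Ite "('i, 'c) qf_formula" "('i, 'c) upd_term" "('i, 'c) upd_term"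
and ('i, 'c) qf_formula =
    Top
  | Eq "('i, 'c) upd_term" "('i, 'c) upd_term"
  | InRel 'i "('i, 'c) upd_term list"
  | AuxRel nat "('i, 'c) upd_term list"
  | Neg "('i, 'c) qf_formula"
  | Conj "('i, 'c) qf_formula" "('i, 'c) qf_formula"
  | Disj "('i, 'c) qf_formula" "('i, 'c) qf_formula"

text \<open>Arities are respected, and the variables are among \<open>x\<^sub>0, \<dots>, x\<^sub>m\<^sub>-\<^sub>1; y\<^sub>0, \<dots>, y\<^sub>n\<^sub>-\<^sub>1\<close>.\<close>

primrec
  wf_term :: "('i \<Rightarrow> nat) \<Rightarrow> aux_schema \<Rightarrow> nat \<Rightarrow> nat \<Rightarrow> ('i, 'c) upd_term \<Rightarrow> bool" and
  wf_formula :: "('i \<Rightarrow> nat) \<Rightarrow> aux_schema \<Rightarrow> nat \<Rightarrow> nat \<Rightarrow> ('i, 'c) qf_formula \<Rightarrow> bool"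
where
  "wf_term ar \<sigma> m n (XVar k) \<longleftrightarrow> k < m"
| "wf_term ar \<sigma> m n (YVar k) \<longleftrightarrow> k < n"
| "wf_term ar \<sigma> m n (Const c) \<longleftrightarrow> True"
| "wf_term ar \<sigma> m n (App f ts) \<longleftrightarrow>
     f \<in> fun_syms \<sigma> \<and> length ts = fun_arity \<sigma> f \<and> list_all (wf_term ar \<sigma> m n) ts"
| "wf_term ar \<sigma> m n (Ite \<phi> t u) \<longleftrightarrow>
     wf_formula ar \<sigma> m n \<phi> \<and> wf_term ar \<sigma> m n t \<and> wf_term ar \<sigma> m n u"
| "wf_formula ar \<sigma> m n Top \<longleftrightarrow> True"
| "wf_formula ar \<sigma> m n (Eq t u) \<longleftrightarrow> wf_term ar \<sigma> m n t \<and> wf_term ar \<sigma> m n u"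
| "wf_formula ar \<sigma> m n (InRel R ts) \<longleftrightarrow>
     length ts = ar R \<and> list_all (wf_term ar \<sigma> m n) ts"
| "wf_formula ar \<sigma> m n (AuxRel R ts) \<longleftrightarrow>
     R \<in> rel_syms \<sigma> \<and> length ts = rel_arity \<sigma> R \<and> list_all (wf_term ar \<sigma> m n) ts"
| "wf_formula ar \<sigma> m n (Neg \<phi>) \<longleftrightarrow> wf_formula ar \<sigma> m n \<phi>"
| "wf_formula ar \<sigma> m n (Conj \<phi> \<psi>) \<longleftrightarrow> wf_formula ar \<sigma> m n \<phi> \<and> wf_formula ar \<sigma> m n \<psi>"
| "wf_formula ar \<sigma> m n (Disj \<phi> \<psi>) \<longleftrightarrow> wf_formula ar \<sigma> m n \<phi> \<and> wf_formula ar \<sigma> m n \<psi>"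

primrec
  eval :: "('i, 'c) database \<Rightarrow> aux_structure \<Rightarrow> nat list \<Rightarrow> nat list \<Rightarrow> ('i, 'c) upd_term \<Rightarrow> nat" and
  sat :: "('i, 'c) database \<Rightarrow> aux_structure \<Rightarrow> nat list \<Rightarrow> nat list \<Rightarrow> ('i, 'c) qf_formula \<Rightarrow> bool"
where
  "eval D X a b (XVar k) = a ! k"
| "eval D X a b (YVar k) = b ! k"
| "eval D X a b (Const c) = const D c"
| "eval D X a b (App f ts) = afun X f (map (eval D X a b) ts)"
| "eval D X a b (Ite \<phi> t u) = (if sat D X a b \<phi> then eval D X a b t else eval D X a b u)"
| "sat D X a b Top \<longleftrightarrow> True"
| "sat D X a b (Eq t u) \<longleftrightarrow> eval D X a b t = eval D X a b u"
| "sat D X a b (InRel R ts) \<longleftrightarrow> map (eval D X a b) ts \<in> irel D R"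
| "sat D X a b (AuxRel R ts) \<longleftrightarrow> map (eval D X a b) ts \<in> arel X R"
| "sat D X a b (Neg \<phi>) \<longleftrightarrow> \<not> sat D X a b \<phi>"
| "sat D X a b (Conj \<phi> \<psi>) \<longleftrightarrow> sat D X a b \<phi> \<and> sat D X a b \<psi>"
| "sat D X a b (Disj \<phi> \<psi>) \<longleftrightarrow> sat D X a b \<phi> \<or> sat D X a b \<psi>"

record ('i, 'c) dyn_program =
  schema :: aux_schema
  upd_rel :: "nat \<Rightarrow> 'i modification \<Rightarrow> ('i, 'c) qf_formula"
  upd_fun :: "nat \<Rightarrow> 'i modification \<Rightarrow> ('i, 'c) upd_term"
  init :: "('i, 'c) database \<Rightarrow> aux_structure"
  query_sym :: nat

definition wf_program :: "('i \<Rightarrow> nat) \<Rightarrow> ('i, 'c) dyn_program \<Rightarrow> bool" where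
  "wf_program ar P \<longleftrightarrow>
     finite (rel_syms (schema P)) \<and> finite (fun_syms (schema P)) \<and>
     query_sym P \<in> rel_syms (schema P) \<and>
     (\<forall>R \<in> rel_syms (schema P). \<forall>\<delta>.
        wf_formula ar (schema P) (ar (mod_sym \<delta>)) (rel_arity (schema P) R) (upd_rel P R \<delta>)) \<and>
     (\<forall>f \<in> fun_syms (schema P). \<forall>\<delta>.
        wf_term ar (schema P) (ar (mod_sym \<delta>)) (fun_arity (schema P) f) (upd_fun P f \<delta>)) \<and>
     (\<forall>D. wf_database ar D \<longrightarrow> wf_aux_structure (schema P) (dom D) (init P D))"

fun modify :: "'i modification \<times> nat list \<Rightarrow> ('i, 'c) database \<Rightarrow> ('i, 'c) database" where
  "modify (Ins R, a) D = D\<lparr>irel := (irel D)(R := insert a (irel D R))\<rparr>"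
| "modify (Del R, a) D = D\<lparr>irel := (irel D)(R := irel D R - {a})\<rparr>"

definition valid_modification ::
    "('i \<Rightarrow> nat) \<Rightarrow> nat set \<Rightarrow> 'i modification \<times> nat list \<Rightarrow> bool" where
  "valid_modification ar A m \<longleftrightarrow> snd m \<in> nlists (ar (mod_sym (fst m))) A"

fun update ::
    "('i, 'c) dyn_program \<Rightarrow> 'i modification \<times> nat list \<Rightarrow> ('i, 'c) database \<Rightarrow> aux_structure
      \<Rightarrow> aux_structure" where
  "update P (\<delta>, a) D X =
     \<lparr>arel = (\<lambda>R. {b \<in> nlists (rel_arity (schema P) R) (dom D). sat D X a b (upd_rel P R \<delta>)}),
      afun = (\<lambda>f b. eval D X a b (upd_fun P f \<delta>))\<rparr>"

fun step ::
    "('i, 'c) dyn_program \<Rightarrow> 'i modification \<times> nat list \<Rightarrow> ('i, 'c) database \<times> aux_structure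
      \<Rightarrow> ('i, 'c) database \<times> aux_structure" where
  "step P m (D, X) = (modify m D, update P m D X)"

text \<open>A \<open>k\<close>-ary query; Boolean queries have \<open>k = 0\<close> and answer \<open>{[]}\<close> (true) or \<open>{}\<close> (false).\<close>

record ('i, 'c) query =
  in_arity :: "'i \<Rightarrow> nat"
  out_arity :: nat
  answer :: "('i, 'c) database \<Rightarrow> nat list set"

definition maintains :: "('i, 'c) dyn_program \<Rightarrow> ('i, 'c) query \<Rightarrow> bool" where
  "maintains P q \<longleftrightarrow>
     rel_arity (schema P) (query_sym P) = out_arity q \<and>
     (\<forall>D \<alpha>. wf_database (in_arity q) D \<longrightarrow>
        (\<forall>m \<in> set \<alpha>. valid_modification (in_arity q) (dom D) m) \<longrightarrow>
        arel (snd (fold (step P) \<alpha> (D, init P D))) (query_sym P) = answer q (fold modify \<alpha> D))"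

definition DynQF :: "('i::finite, 'c::finite) query set" where
  "DynQF = {q. \<exists>P. wf_program (in_arity q) P \<and> maintains P q}"

definition unary_schema :: "aux_schema \<Rightarrow> bool" where
  "unary_schema \<sigma> \<longleftrightarrow>
     (\<forall>R \<in> rel_syms \<sigma>. rel_arity \<sigma> R \<le> 1) \<and> (\<forall>f \<in> fun_syms \<sigma>. fun_arity \<sigma> f \<le> 1)"

definition unary_DynQF :: "('i::finite, 'c::finite) query set" where
  "unary_DynQF =
     {q. \<exists>P. wf_program (in_arity q) P \<and> unary_schema (schema P) \<and> maintains P q}"

datatype st_rel = E
datatype st_const = s | t

instance st_rel :: finite
proof
  have "(UNIV :: st_rel set) = {E}" using st_rel.exhaust by auto
  then show "finite (UNIV :: st_rel set)" by (metis finite.emptyI finite_insert)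
qed

instance st_const :: finite
proof
  have "(UNIV :: st_const set) = {s, t}" using st_const.exhaust by auto
  then show "finite (UNIV :: st_const set)" by (metis finite.emptyI finite_insert)
qed

definition st_reachability :: "(st_rel, st_const) query" where
  "st_reachability =
     \<lparr>in_arity = (\<lambda>_. 2),
      out_arity = 0,
      answer = (\<lambda>D. if (const D s, const D t) \<in> {(u, v). [u, v] \<in> irel D E}\<^sup>* then {[]} else {})\<rparr>"

hide_const (open) E s t

end

theory Submission
  imports "HOL-Library.FuncSet" "HOL-Real_Asymp.Real_Asymp" Defs
begin

text \<open>
  The initial auxiliary data of a unary program cannot make a quadratic number of bits accessible
  from a linear number of nodes. Take a graph with \<open>n\<close> left nodes, \<open>n\<close> right nodes and \<open>n\<^sup>2\<close> middle
  nodes, where \<open>x \<mapsto> (l x, r x)\<close> maps the middle nodes bijectively to pairs of a left and a right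
  node. For a set \<open>R\<close> of middle nodes, the edges are \<open>l x \<rightarrow> x\<close> for all \<open>x\<close> and \<open>x \<rightarrow> r x\<close> for
  \<open>x \<in> R\<close>. Inserting \<open>s \<rightarrow> l x\<close> and \<open>r x \<rightarrow> t\<close> makes \<open>t\<close> reachable from \<open>s\<close> iff \<open>x \<in> R\<close>, so \<open>R\<close> can
  be read off the initial state by probes that touch only the \<open>2 + 2n\<close> nodes \<open>s\<close>, \<open>t\<close>, left and
  right. Two quantifier-free updates see only what lies within boundedly many function applications
  of these nodes. As the functions are unary, that neighbourhood has \<open>O(n)\<close> of the \<open>O(n\<^sup>2)\<close> nodes, and
  each node carries \<open>O(log n)\<close> bits. This leaves \<open>2\<^bsup>O(n log n)\<^esup>\<close> views, fewer than the \<open>2\<^bsup>n\<^sup>2\<^esup>\<close>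
  sets \<open>R\<close>.
\<close>

declare nlistsE_length [simp del] nlistsE_set [simp del]

section \<open>Fixed-length lists and bounded subsets\<close>

lemma finite_nlists: "finite A \<Longrightarrow> finite (nlists n A)"
  using finite_lists_length_eq[of A n] by (simp add: nlists_def conj_commute)

lemma card_nlists: "finite A \<Longrightarrow> card (nlists n A) = card A ^ n"
  using card_lists_length_eq[of A n] by (simp add: nlists_def conj_commute)

lemma nlists_eq_replicate_image:
  assumes "k \<le> 1" "A \<noteq> {}"
  shows "nlists k A = replicate k ` A"
proof (cases k)
  case 0
  then show ?thesis using assms(2) by auto
next
  case (Suc j)
  then show ?thesis using assms(1) by (auto simp: nlists_Suc)
qed

lemma ex_nlists_set_eq:
  assumes "finite A" "A \<noteq> {}" "card A \<le> n"
  shows "\<exists>xs \<in> nlists n A. set xs = A"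
proof -
  obtain xs where xs: "set xs = A" "length xs = card A"
    using assms(1) by (metis distinct_card finite_distinct_list)
  obtain x where "x \<in> A" using assms(2) by blast
  then show ?thesis
    using xs assms(3) by (intro bexI[of _ "xs @ replicate (n - card A) x"] nlistsI) auto
qed

lemma finite_bounded_subsets:
  "finite A \<Longrightarrow> finite {B. B \<subseteq> A \<and> B \<noteq> {} \<and> card B \<le> n}"
  by (auto intro: finite_subset[of _ "Pow A"])

lemma card_bounded_subsets_le:
  assumes "finite A"
  shows "card {B. B \<subseteq> A \<and> B \<noteq> {} \<and> card B \<le> n} \<le> card A ^ n"
proof -
  have "{B. B \<subseteq> A \<and> B \<noteq> {} \<and> card B \<le> n} \<subseteq> set ` nlists n A"
  proof
    fix B assume B: "B \<in> {B. B \<subseteq> A \<and> B \<noteq> {} \<and> card B \<le> n}"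
    then obtain xs where "xs \<in> nlists n B" "set xs = B"
      using ex_nlists_set_eq[of B n] finite_subset[OF _ assms] by blast
    then show "B \<in> set ` nlists n A" using B nlists_mono[of B A n] by blast
  qed
  then have "card {B. B \<subseteq> A \<and> B \<noteq> {} \<and> card B \<le> n} \<le> card (nlists n A)"
    by (rule surj_card_le[OF finite_nlists[OF assms]])
  then show ?thesis by (simp add: card_nlists[OF assms])
qed

section \<open>Neighbourhoods\<close>

primrec nbhd :: "aux_schema \<Rightarrow> aux_structure \<Rightarrow> nat \<Rightarrow> nat set \<Rightarrow> nat set" where
  "nbhd \<sigma> X 0 S = S"
| "nbhd \<sigma> X (Suc k) S = nbhd \<sigma> X k S \<union>
     (\<Union>f \<in> fun_syms \<sigma>. afun X f ` nlists (fun_arity \<sigma> f) (nbhd \<sigma> X k S))"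

lemma nbhd_add: "nbhd \<sigma> X (j + k) S = nbhd \<sigma> X k (nbhd \<sigma> X j S)"
  by (induction k) auto

lemma nbhd_mono_radius: "j \<le> k \<Longrightarrow> nbhd \<sigma> X j S \<subseteq> nbhd \<sigma> X k S"
  by (induction k) (auto simp: le_Suc_eq)

lemma subset_nbhd: "S \<subseteq> nbhd \<sigma> X k S"
  using nbhd_mono_radius[of 0 k] by simp

lemma nbhd_subset:
  assumes "wf_aux_structure \<sigma> A X" "S \<subseteq> A"
  shows "nbhd \<sigma> X k S \<subseteq> A"
proof (induction k)
  case (Suc k)
  then show ?case using assms(1) by (fastforce simp: wf_aux_structure_def nlists_def)
qed (simp add: assms(2))

lemma finite_nbhd: "finite (fun_syms \<sigma>) \<Longrightarrow> finite S \<Longrightarrow> finite (nbhd \<sigma> X k S)"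
  by (induction k) (simp_all add: finite_nlists)

lemma card_nbhd_1_le:
  assumes "unary_schema \<sigma>" "finite (fun_syms \<sigma>)" "finite S" "S \<noteq> {}"
  shows "card (nbhd \<sigma> X 1 S) \<le> (1 + card (fun_syms \<sigma>)) * card S"
proof -
  let ?N = "\<lambda>f. afun X f ` nlists (fun_arity \<sigma> f) S"
  have "card (?N f) \<le> card S" if "f \<in> fun_syms \<sigma>" for f
  proof -
    have "nlists (fun_arity \<sigma> f) S = replicate (fun_arity \<sigma> f) ` S"
      using assms that by (intro nlists_eq_replicate_image) (simp_all add: unary_schema_def)
    then show ?thesis using assms(3) by (simp add: image_image card_image_le)
  qed
  then have "(\<Sum>f \<in> fun_syms \<sigma>. card (?N f)) \<le> card (fun_syms \<sigma>) * card S"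
    using sum_bounded_above[of "fun_syms \<sigma>" "\<lambda>f. card (?N f)" "card S"] by simp
  moreover have "card (nbhd \<sigma> X 1 S) \<le> card S + card (\<Union>f \<in> fun_syms \<sigma>. ?N f)"
    using card_Un_le by simp
  moreover have "card (\<Union>f \<in> fun_syms \<sigma>. ?N f) \<le> (\<Sum>f \<in> fun_syms \<sigma>. card (?N f))"
    by (rule card_UN_le[OF assms(2)])
  ultimately show ?thesis by simp
qed

lemma card_nbhd_le:
  assumes "unary_schema \<sigma>" "finite (fun_syms \<sigma>)" "finite S" "S \<noteq> {}"
  shows "card (nbhd \<sigma> X k S) \<le> (1 + card (fun_syms \<sigma>)) ^ k * card S"
proof (induction k)
  case (Suc k)
  have "nbhd \<sigma> X k S \<noteq> {}" using assms(4) subset_nbhd by blast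
  then have "card (nbhd \<sigma> X (k + 1) S) \<le> (1 + card (fun_syms \<sigma>)) * card (nbhd \<sigma> X k S)"
    unfolding nbhd_add using assms by (intro card_nbhd_1_le finite_nbhd)
  also have "\<dots> \<le> (1 + card (fun_syms \<sigma>)) * ((1 + card (fun_syms \<sigma>)) ^ k * card S)"
    by (intro mult_le_mono2 Suc)
  finally show ?case by (simp only: Suc_eq_plus1[symmetric] power_Suc mult.assoc)
qed simp

section \<open>Locality of update terms and formulas\<close>

primrec
  term_depth :: "('i, 'c) upd_term \<Rightarrow> nat" and
  formula_depth :: "('i, 'c) qf_formula \<Rightarrow> nat"
where
  "term_depth (XVar k) = 0"
| "term_depth (YVar k) = 0"
| "term_depth (Const c) = 0"
| "term_depth (App f ts) = Suc (Max (set (0 # map term_depth ts)))"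
| "term_depth (Ite \<phi> t u) = max (formula_depth \<phi>) (max (term_depth t) (term_depth u))"
| "formula_depth Top = 0"
| "formula_depth (Eq t u) = max (term_depth t) (term_depth u)"
| "formula_depth (InRel R ts) = Max (set (0 # map term_depth ts))"
| "formula_depth (AuxRel R ts) = Max (set (0 # map term_depth ts))"
| "formula_depth (Neg \<phi>) = formula_depth \<phi>"
| "formula_depth (Conj \<phi> \<psi>) = max (formula_depth \<phi>) (formula_depth \<psi>)"
| "formula_depth (Disj \<phi> \<psi>) = max (formula_depth \<phi>) (formula_depth \<psi>)"

lemma eval_mem_nbhd:
  fixes v :: "('i, 'c) upd_term"
  assumes "set a \<subseteq> S" "set b \<subseteq> S" "range (const D) \<subseteq> S"
  shows "wf_term ar \<sigma> (length a) (length b) v \<Longrightarrow> term_depth v \<le> k \<Longrightarrow>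
    eval D X a b v \<in> nbhd \<sigma> X k S"
proof (induction v arbitrary: k rule: upd_term.induct[where ?P2.0 = "\<lambda>_. True"])
  case (XVar i)
  then show ?case using assms(1) subset_nbhd[of S] nth_mem by fastforce
next
  case (YVar i)
  then show ?case using assms(2) subset_nbhd[of S] nth_mem by fastforce
next
  case (Const c)
  then show ?case using assms(3) subset_nbhd[of S] by fastforce
next
  case (App f ts)
  then obtain j where k: "k = Suc j" by (cases k) auto
  have "map (eval D X a b) ts \<in> nlists (fun_arity \<sigma> f) (nbhd \<sigma> X j S)"
    using App by (auto simp: k list_all_iff intro!: nlistsI)
  then show ?case using App.prems(1) by (auto simp: k)
qed simp_all

definition db_agree :: "nat set \<Rightarrow> ('i, 'c) database \<Rightarrow> ('i, 'c) database \<Rightarrow> bool" where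
  "db_agree W D D' \<longleftrightarrow>
     dom D = dom D' \<and> const D = const D' \<and>
     (\<forall>R. \<forall>xs \<in> lists W. xs \<in> irel D R \<longleftrightarrow> xs \<in> irel D' R)"

definition aux_agree :: "aux_schema \<Rightarrow> nat set \<Rightarrow> aux_structure \<Rightarrow> aux_structure \<Rightarrow> bool" where
  "aux_agree \<sigma> W X X' \<longleftrightarrow>
     (\<forall>R \<in> rel_syms \<sigma>. \<forall>xs \<in> nlists (rel_arity \<sigma> R) W. xs \<in> arel X R \<longleftrightarrow> xs \<in> arel X' R) \<and>
     (\<forall>f \<in> fun_syms \<sigma>. \<forall>xs \<in> nlists (fun_arity \<sigma> f) W. afun X f xs = afun X' f xs)"

fun agree_on ::
    "aux_schema \<Rightarrow> nat set \<Rightarrow> ('i, 'c) database \<times> aux_structure \<Rightarrow>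
     ('i, 'c) database \<times> aux_structure \<Rightarrow> bool" where
  "agree_on \<sigma> W (D, X) (D', X') \<longleftrightarrow> db_agree W D D' \<and> aux_agree \<sigma> W X X'"

lemma db_agree_mono: "db_agree W D D' \<Longrightarrow> V \<subseteq> W \<Longrightarrow> db_agree V D D'"
  unfolding db_agree_def by (meson lists_mono subsetD)

lemma aux_agree_mono: "aux_agree \<sigma> W X X' \<Longrightarrow> V \<subseteq> W \<Longrightarrow> aux_agree \<sigma> V X X'"
  unfolding aux_agree_def by (meson nlists_mono subsetD)

lemma agree_on_mono: "agree_on \<sigma> W st st' \<Longrightarrow> V \<subseteq> W \<Longrightarrow> agree_on \<sigma> V st st'"
  by (cases st; cases st') (auto intro: db_agree_mono aux_agree_mono)

lemma db_agree_modify: "db_agree W D D' \<Longrightarrow> db_agree W (modify m D) (modify m D')"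
  by (cases "(m, D)" rule: modify.cases) (auto simp: db_agree_def)

lemma
  fixes v :: "('i, 'c) upd_term" and \<phi> :: "('i, 'c) qf_formula"
  assumes agree: "agree_on \<sigma> (nbhd \<sigma> X k S) (D, X) (D', X')"
    and S: "set a \<subseteq> S" "set b \<subseteq> S" "range (const D) \<subseteq> S"
  shows eval_agree: "wf_term ar \<sigma> (length a) (length b) v \<Longrightarrow> term_depth v \<le> k \<Longrightarrow>
      eval D' X' a b v = eval D X a b v"
    and sat_agree: "wf_formula ar \<sigma> (length a) (length b) \<phi> \<Longrightarrow> formula_depth \<phi> \<le> k \<Longrightarrow>
      sat D' X' a b \<phi> = sat D X a b \<phi>"
proof (induction v and \<phi>)
  have args: "map (eval D X a b) ts \<in> nlists (length ts) (nbhd \<sigma> X k S)"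
    if "list_all (wf_term ar \<sigma> (length a) (length b)) ts" "\<forall>t \<in> set ts. term_depth t \<le> k" for ts
    using that eval_mem_nbhd[OF S] by (auto simp: list_all_iff intro!: nlistsI)
  {
    case (Const c)
    then show ?case using agree by (simp add: db_agree_def)
  next
    case (App f ts)
    then have "\<forall>t \<in> set ts. term_depth t \<le> k" by (simp add: Suc_le_eq less_imp_le)
    then have "map (eval D X a b) ts \<in> nlists (fun_arity \<sigma> f) (nbhd \<sigma> X k S)"
      and "map (eval D' X' a b) ts = map (eval D X a b) ts"
      using App args[of ts] by (simp_all add: list_all_iff)
    then show ?case using App.prems agree by (simp add: aux_agree_def del: map_eq_conv)
  next
    case (InRel R ts)
    then have "map (eval D' X' a b) ts = map (eval D X a b) ts" by (simp add: list_all_iff)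
    moreover have "map (eval D X a b) ts \<in> lists (nbhd \<sigma> X k S)"
      using args[of ts] InRel.prems by (simp add: nlists_def in_lists_conv_set subset_iff)
    ultimately show ?case using agree by (simp add: db_agree_def del: map_eq_conv)
  next
    case (AuxRel R ts)
    then have "map (eval D X a b) ts \<in> nlists (rel_arity \<sigma> R) (nbhd \<sigma> X k S)"
      and "map (eval D' X' a b) ts = map (eval D X a b) ts"
      using args[of ts] by (simp_all add: list_all_iff)
    then show ?case using AuxRel.prems agree by (simp add: aux_agree_def del: map_eq_conv)
  }
qed simp_all

section \<open>Locality of dynamic programs\<close>

lemma finite_modification: "finite (UNIV :: 'i::finite modification set)"
proof -
  have "m \<in> range Ins \<union> range Del" for m :: "'i modification" by (cases m) auto
  then have "UNIV \<subseteq> (range Ins \<union> range Del :: 'i modification set)" by blast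
  then show ?thesis by (rule finite_subset) simp
qed

lemma dom_modify [simp]: "dom (modify m D) = dom D"
  by (cases "(m, D)" rule: modify.cases) auto

lemma const_modify [simp]: "const (modify m D) = const D"
  by (cases "(m, D)" rule: modify.cases) auto

lemma valid_modification_mono:
  "valid_modification ar S m \<Longrightarrow> S \<subseteq> W \<Longrightarrow> valid_modification ar W m"
  unfolding valid_modification_def using nlists_mono by blast

locale depth_bounded_program =
  fixes ar :: "'i \<Rightarrow> nat" and P :: "('i, 'c) dyn_program" and d :: nat
  assumes wf_program: "wf_program ar P"
    and formula_depth_le: "R \<in> rel_syms (schema P) \<Longrightarrow> formula_depth (upd_rel P R \<delta>) \<le> d"
    and term_depth_le: "f \<in> fun_syms (schema P) \<Longrightarrow> term_depth (upd_fun P f \<delta>) \<le> d"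

lemma ex_depth_bounded_program:
  fixes P :: "('i::finite, 'c) dyn_program"
  assumes "wf_program ar P"
  shows "\<exists>d. depth_bounded_program ar P d"
proof -
  let ?F = "\<Union>R \<in> rel_syms (schema P). range (\<lambda>\<delta>. formula_depth (upd_rel P R \<delta>))"
  let ?T = "\<Union>f \<in> fun_syms (schema P). range (\<lambda>\<delta>. term_depth (upd_fun P f \<delta>))"
  have "finite (?F \<union> ?T)"
    using assms finite_modification[where 'i = 'i] by (simp add: wf_program_def)
  then obtain d where "\<forall>k \<in> ?F \<union> ?T. k \<le> d" by (meson finite_nat_set_iff_bounded_le)
  then have "depth_bounded_program ar P d" using assms by unfold_locales (simp_all add: ball_Un)
  then show ?thesis by blast
qed

text \<open>
  An application of an updated function unfolds into at most \<open>d\<close> nested applications of the old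
  ones, and reading off the updated data at the elements so reached takes another \<open>d\<close>.
\<close>

primrec locality_radius :: "nat \<Rightarrow> nat \<Rightarrow> nat" where
  "locality_radius d 0 = 0"
| "locality_radius d (Suc m) = locality_radius d m * d + d"

context depth_bounded_program
begin

lemma afun_update_mem_nbhd:
  assumes "f \<in> fun_syms (schema P)" "xs \<in> nlists (fun_arity (schema P) f) W"
    and "valid_modification ar W (\<delta>, a)" "range (const D) \<subseteq> W"
  shows "afun (update P (\<delta>, a) D X) f xs \<in> nbhd (schema P) X d W"
proof -
  have "wf_term ar (schema P) (length a) (length xs) (upd_fun P f \<delta>)"
    using assms wf_program by (simp add: wf_program_def valid_modification_def nlists_def)
  then show ?thesis
    using eval_mem_nbhd[of a W xs D] assms term_depth_le
    by (simp add: valid_modification_def nlists_def)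
qed

lemma nbhd_update_subset:
  assumes "valid_modification ar S (\<delta>, a)" "range (const D) \<subseteq> S"
  shows "nbhd (schema P) (update P (\<delta>, a) D X) k S \<subseteq> nbhd (schema P) X (k * d) S"
proof (induction k)
  case (Suc k)
  let ?\<sigma> = "schema P" and ?X = "update P (\<delta>, a) D X" and ?W = "nbhd (schema P) X (k * d) S"
  have "S \<subseteq> ?W" by (rule subset_nbhd)
  then have W: "valid_modification ar ?W (\<delta>, a)" "range (const D) \<subseteq> ?W"
    using assms by (auto intro: valid_modification_mono)
  have new: "afun ?X f xs \<in> nbhd ?\<sigma> X d ?W"
    if "f \<in> fun_syms ?\<sigma>" "xs \<in> nlists (fun_arity ?\<sigma> f) (nbhd ?\<sigma> ?X k S)" for f xs
    using that(1) subsetD[OF nlists_mono[OF Suc] that(2)] W by (rule afun_update_mem_nbhd)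
  have "nbhd ?\<sigma> ?X (Suc k) S \<subseteq> nbhd ?\<sigma> X d ?W"
    using new Suc subset_nbhd[of ?W ?\<sigma> X d] by (auto simp del: update.simps)
  then show ?case by (simp add: nbhd_add[symmetric] add.commute)
qed simp

lemma aux_agree_update:
  assumes agree: "agree_on (schema P) (nbhd (schema P) X d W) (D, X) (D', X')"
    and W: "valid_modification ar W (\<delta>, a)" "range (const D) \<subseteq> W"
  shows "aux_agree (schema P) W (update P (\<delta>, a) D X) (update P (\<delta>, a) D' X')"
proof -
  let ?\<sigma> = "schema P"
  have a: "length a = ar (mod_sym \<delta>)" "set a \<subseteq> W"
    using W(1) by (simp_all add: valid_modification_def nlists_def)
  have "eval D' X' a xs (upd_fun P f \<delta>) = eval D X a xs (upd_fun P f \<delta>)"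
    if f: "f \<in> fun_syms ?\<sigma>" and xs: "xs \<in> nlists (fun_arity ?\<sigma> f) W" for f xs
  proof (rule eval_agree[OF agree a(2) _ W(2)])
    show "wf_term ar ?\<sigma> (length a) (length xs) (upd_fun P f \<delta>)"
      using wf_program f xs a by (simp add: wf_program_def nlists_def)
  qed (use xs term_depth_le[OF f] in \<open>simp_all add: nlists_def\<close>)
  moreover have "sat D' X' a xs (upd_rel P R \<delta>) = sat D X a xs (upd_rel P R \<delta>)"
    if R: "R \<in> rel_syms ?\<sigma>" and xs: "xs \<in> nlists (rel_arity ?\<sigma> R) W" for R xs
  proof (rule sat_agree[OF agree a(2) _ W(2)])
    show "wf_formula ar ?\<sigma> (length a) (length xs) (upd_rel P R \<delta>)"
      using wf_program R xs a by (simp add: wf_program_def nlists_def)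
  qed (use xs formula_depth_le[OF R] in \<open>simp_all add: nlists_def\<close>)
  moreover have "dom D = dom D'" using agree by (simp add: db_agree_def)
  ultimately show ?thesis by (simp add: aux_agree_def)
qed

lemma agree_on_step:
  assumes agree: "agree_on (schema P) (nbhd (schema P) X (k * d + d) S) (D, X) (D', X')"
    and S: "valid_modification ar S (\<delta>, a)" "range (const D) \<subseteq> S"
  shows "agree_on (schema P) (nbhd (schema P) (update P (\<delta>, a) D X) k S)
    (step P (\<delta>, a) (D, X)) (step P (\<delta>, a) (D', X'))"
proof -
  let ?W = "nbhd (schema P) X (k * d) S"
  have "S \<subseteq> ?W" by (rule subset_nbhd)
  then have W: "valid_modification ar ?W (\<delta>, a)" "range (const D) \<subseteq> ?W"
    using S by (auto intro: valid_modification_mono)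
  have "aux_agree (schema P) ?W (update P (\<delta>, a) D X) (update P (\<delta>, a) D' X')"
    using agree W by (intro aux_agree_update) (simp_all only: nbhd_add)
  moreover have "db_agree (nbhd (schema P) X d ?W) D D'" using agree by (simp add: nbhd_add)
  then have "db_agree ?W (modify (\<delta>, a) D) (modify (\<delta>, a) D')"
    by (rule db_agree_modify[OF db_agree_mono[OF _ subset_nbhd]])
  ultimately have "agree_on (schema P) ?W (step P (\<delta>, a) (D, X)) (step P (\<delta>, a) (D', X'))"
    by (simp only: step.simps agree_on.simps simp_thms)
  then show ?thesis using nbhd_update_subset[OF S] by (rule agree_on_mono)
qed

lemma agree_on_fold_step:
  assumes "agree_on (schema P) (nbhd (schema P) X (locality_radius d (length \<alpha>)) S) (D, X) (D', X')"
    and "\<forall>m \<in> set \<alpha>. valid_modification ar S m" "range (const D) \<subseteq> S"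
  shows "agree_on (schema P) S (fold (step P) \<alpha> (D, X)) (fold (step P) \<alpha> (D', X'))"
  using assms
proof (induction \<alpha> arbitrary: D X D' X')
  case (Cons m \<alpha>)
  obtain \<delta> a where m: "m = (\<delta>, a)" by force
  have "agree_on (schema P) (nbhd (schema P) (update P m D X) (locality_radius d (length \<alpha>)) S)
      (step P m (D, X)) (step P m (D', X'))"
    using Cons.prems unfolding m by (intro agree_on_step) simp_all
  then show ?case
    using Cons.prems Cons.IH[of "update P m D X" "modify m D"] by (simp del: agree_on.simps)
qed simp

lemma answer_agree:
  assumes P: "maintains P q" "in_arity q = ar"
    and wf: "wf_database ar D" "wf_database ar D'"
    and S: "S \<subseteq> dom D" "\<forall>m \<in> set \<alpha>. valid_modification ar S m" "range (const D) \<subseteq> S"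
    and agree: "agree_on (schema P) (nbhd (schema P) (init P D) (locality_radius d (length \<alpha>)) S)
      (D, init P D) (D', init P D')"
    and xs: "xs \<in> nlists (out_arity q) S"
  shows "xs \<in> answer q (fold modify \<alpha> D) \<longleftrightarrow> xs \<in> answer q (fold modify \<alpha> D')"
proof -
  let ?st = "\<lambda>D. fold (step P) \<alpha> (D, init P D)"
  have "agree_on (schema P) S (?st D) (?st D')"
    using agree S by (intro agree_on_fold_step)
  then have "aux_agree (schema P) S (snd (?st D)) (snd (?st D'))"
    by (cases "?st D"; cases "?st D'") simp
  moreover have "query_sym P \<in> rel_syms (schema P)" "rel_arity (schema P) (query_sym P) = out_arity q"
    using wf_program P by (simp_all add: wf_program_def maintains_def)
  ultimately have "xs \<in> arel (snd (?st D)) (query_sym P) \<longleftrightarrow> xs \<in> arel (snd (?st D')) (query_sym P)"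
    using xs by (simp add: aux_agree_def)
  moreover have "arel (snd (?st D)) (query_sym P) = answer q (fold modify \<alpha> D)"
    "arel (snd (?st D')) (query_sym P) = answer q (fold modify \<alpha> D')"
  proof -
    have "dom D' = dom D" using agree by (simp add: db_agree_def)
    moreover have "\<forall>m \<in> set \<alpha>. valid_modification ar (dom D) m"
      using S valid_modification_mono by blast
    ultimately show "arel (snd (?st D)) (query_sym P) = answer q (fold modify \<alpha> D)"
      "arel (snd (?st D')) (query_sym P) = answer q (fold modify \<alpha> D')"
      using P wf by (simp_all add: maintains_def)
  qed
  ultimately show ?thesis by simp
qed

end

section \<open>Counting local views\<close>

text \<open>The argument list \<open>replicate k x\<close> covers the arities \<open>0\<close> and \<open>1\<close> uniformly.\<close>

definition aux_type :: "aux_schema \<Rightarrow> aux_structure \<Rightarrow> nat \<Rightarrow> (nat \<Rightarrow> nat) \<times> nat set" where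
  "aux_type \<sigma> X x =
     (\<lambda>f \<in> fun_syms \<sigma>. afun X f (replicate (fun_arity \<sigma> f) x),
      {R \<in> rel_syms \<sigma>. replicate (rel_arity \<sigma> R) x \<in> arel X R})"

definition aux_types :: "aux_schema \<Rightarrow> nat set \<Rightarrow> ((nat \<Rightarrow> nat) \<times> nat set) set" where
  "aux_types \<sigma> A = (fun_syms \<sigma> \<rightarrow>\<^sub>E A) \<times> Pow (rel_syms \<sigma>)"

lemma aux_type_in_aux_types:
  assumes "wf_aux_structure \<sigma> A X" "x \<in> A"
  shows "aux_type \<sigma> X x \<in> aux_types \<sigma> A"
  using assms by (auto simp: aux_type_def aux_types_def wf_aux_structure_def nlists_replicateI)

lemma finite_aux_types:
  "finite (fun_syms \<sigma>) \<Longrightarrow> finite (rel_syms \<sigma>) \<Longrightarrow> finite A \<Longrightarrow> finite (aux_types \<sigma> A)"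
  by (simp add: aux_types_def finite_PiE)

lemma card_aux_types:
  assumes "finite (fun_syms \<sigma>)" "finite (rel_syms \<sigma>)"
  shows "card (aux_types \<sigma> A) = card A ^ card (fun_syms \<sigma>) * 2 ^ card (rel_syms \<sigma>)"
  using assms by (simp add: aux_types_def card_cartesian_product card_PiE card_Pow)

lemma card_labels_le:
  assumes "finite (fun_syms \<sigma>)" "finite (rel_syms \<sigma>)" "1 \<le> card A"
  shows "card (A \<times> (UNIV :: bool set) \<times> aux_types \<sigma> A)
    \<le> (2 * card A) ^ (1 + card (fun_syms \<sigma>) + card (rel_syms \<sigma>))"
proof -
  let ?F = "card (fun_syms \<sigma>)" and ?L = "card (rel_syms \<sigma>)"
  have "card (A \<times> (UNIV :: bool set) \<times> aux_types \<sigma> A) = 2 ^ (1 + ?L) * card A ^ (1 + ?F)"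
    using assms(1,2) by (simp add: card_cartesian_product card_aux_types)
  also have "\<dots> \<le> 2 ^ (1 + ?F + ?L) * card A ^ (1 + ?F + ?L)"
    using assms(3) by (intro mult_le_mono power_increasing) simp_all
  finally show ?thesis by (simp only: power_mult_distrib)
qed

lemma aux_agree_if_aux_type_eq:
  assumes "unary_schema \<sigma>" "W \<noteq> {}" and type: "\<forall>x \<in> W. aux_type \<sigma> X x = aux_type \<sigma> X' x"
  shows "aux_agree \<sigma> W X X'"
  unfolding aux_agree_def
proof (intro conjI ballI)
  fix R xs assume R: "R \<in> rel_syms \<sigma>" and "xs \<in> nlists (rel_arity \<sigma> R) W"
  then obtain x where "x \<in> W" "xs = replicate (rel_arity \<sigma> R) x"
    using assms(1,2) nlists_eq_replicate_image[of "rel_arity \<sigma> R" W] by (auto simp: unary_schema_def)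
  then show "xs \<in> arel X R \<longleftrightarrow> xs \<in> arel X' R"
    using type R by (auto simp: aux_type_def set_eq_iff)
next
  fix f xs assume f: "f \<in> fun_syms \<sigma>" and "xs \<in> nlists (fun_arity \<sigma> f) W"
  then obtain x where x: "x \<in> W" "xs = replicate (fun_arity \<sigma> f) x"
    using assms(1,2) nlists_eq_replicate_image[of "fun_arity \<sigma> f" W] by (auto simp: unary_schema_def)
  then have "fst (aux_type \<sigma> X x) f = fst (aux_type \<sigma> X' x) f" using type by simp
  then show "afun X f xs = afun X' f xs" using x f by (simp add: aux_type_def)
qed

text \<open>
  A set \<open>R \<subseteq> M\<close> is stored in \<open>G R\<close> so that its elements can be read off while touching only \<open>S\<close>.
\<close>

locale probed_encoding =
  fixes q :: "('i, 'c) query" and m :: nat and A S M :: "nat set"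
    and G :: "nat set \<Rightarrow> ('i, 'c) database"
    and probe :: "nat \<Rightarrow> ('i modification \<times> nat list) list"
  assumes out_arity: "out_arity q = 0"
    and wf_encoding: "R \<subseteq> M \<Longrightarrow> wf_database (in_arity q) (G R)"
    and dom_encoding: "R \<subseteq> M \<Longrightarrow> dom (G R) = A"
    and const_encoding: "R \<subseteq> M \<Longrightarrow> range (const (G R)) \<subseteq> S"
    and touched_subset: "S \<subseteq> A"
    and encoding_local:
      "R \<subseteq> M \<Longrightarrow> R' \<subseteq> M \<Longrightarrow> R \<inter> W = R' \<inter> W \<Longrightarrow> db_agree W (G R) (G R')"
    and length_probe: "x \<in> M \<Longrightarrow> length (probe x) = m"
    and probe_valid: "x \<in> M \<Longrightarrow> \<forall>\<mu> \<in> set (probe x). valid_modification (in_arity q) S \<mu>"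
    and probe_answer:
      "R \<subseteq> M \<Longrightarrow> x \<in> M \<Longrightarrow> [] \<in> answer q (fold modify (probe x) (G R)) \<longleftrightarrow> x \<in> R"
begin

lemma finite_domain: "finite A"
  using wf_encoding[of "{}"] dom_encoding[of "{}"] by (simp add: wf_database_def)

lemma touched_nonempty: "S \<noteq> {}"
  using const_encoding[of "{}"] by auto

lemma eq_if_agree_on:
  assumes "depth_bounded_program (in_arity q) P d" "maintains P q" and R: "R \<subseteq> M" "R' \<subseteq> M"
    and agree: "agree_on (schema P) (nbhd (schema P) (init P (G R)) (locality_radius d m) S)
      (G R, init P (G R)) (G R', init P (G R'))"
  shows "R = R'"
proof -
  interpret depth_bounded_program "in_arity q" P d by fact
  have "x \<in> R \<longleftrightarrow> x \<in> R'" if x: "x \<in> M" for x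
  proof -
    have "[] \<in> answer q (fold modify (probe x) (G R)) \<longleftrightarrow>
        [] \<in> answer q (fold modify (probe x) (G R'))"
    proof (rule answer_agree)
      show "S \<subseteq> dom (G R)" using R touched_subset by (simp add: dom_encoding)
    qed (use assms x out_arity wf_encoding const_encoding length_probe probe_valid in simp_all)
    then show ?thesis using R x by (simp add: probe_answer)
  qed
  then show ?thesis using R by blast
qed

definition view ::
    "('i, 'c) dyn_program \<Rightarrow> nat \<Rightarrow> nat set \<Rightarrow> (nat \<times> bool \<times> (nat \<Rightarrow> nat) \<times> nat set) set" where
  "view P d R = (\<lambda>x. (x, x \<in> R, aux_type (schema P) (init P (G R)) x)) `
     nbhd (schema P) (init P (G R)) (locality_radius d m) S"

lemma inj_on_view:
  assumes P: "depth_bounded_program (in_arity q) P d" "maintains P q" and "unary_schema (schema P)"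
  shows "inj_on (view P d) (Pow M)"
proof (rule inj_onI)
  fix R R' assume R: "R \<in> Pow M" "R' \<in> Pow M" and eq: "view P d R = view P d R'"
  let ?X = "\<lambda>R. init P (G R)"
  let ?W = "nbhd (schema P) (?X R) (locality_radius d m) S"
  have view: "(x \<in> R \<longleftrightarrow> x \<in> R') \<and> aux_type (schema P) (?X R) x = aux_type (schema P) (?X R') x"
    if "x \<in> ?W" for x
  proof -
    have "(x, x \<in> R, aux_type (schema P) (?X R) x) \<in> view P d R"
      using that by (simp add: view_def)
    then show ?thesis unfolding eq by (auto simp: view_def)
  qed
  have "?W \<noteq> {}" using touched_nonempty subset_nbhd by blast
  with view have "aux_agree (schema P) ?W (?X R) (?X R')"
    using assms(3) by (intro aux_agree_if_aux_type_eq) auto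
  moreover have "db_agree ?W (G R) (G R')" using R view by (intro encoding_local) auto
  ultimately show "R = R'" using R by (intro eq_if_agree_on[OF P]) simp_all
qed

lemma view_bounded:
  assumes "wf_program (in_arity q) P" "unary_schema (schema P)" "R \<subseteq> M"
  shows "view P d R \<subseteq> A \<times> UNIV \<times> aux_types (schema P) A" "view P d R \<noteq> {}"
    and "card (view P d R) \<le> (1 + card (fun_syms (schema P))) ^ locality_radius d m * card S"
proof -
  let ?\<sigma> = "schema P" and ?X = "init P (G R)"
  let ?W = "nbhd ?\<sigma> ?X (locality_radius d m) S"
  have X: "wf_aux_structure ?\<sigma> A ?X"
    using assms wf_encoding dom_encoding unfolding wf_program_def by blast
  then have "?W \<subseteq> A" using touched_subset by (rule nbhd_subset)
  then show "view P d R \<subseteq> A \<times> UNIV \<times> aux_types ?\<sigma> A"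
    using aux_type_in_aux_types[OF X] by (auto simp: view_def)
  show "view P d R \<noteq> {}" using touched_nonempty subset_nbhd unfolding view_def by blast
  have "finite (fun_syms ?\<sigma>)" using assms(1) by (simp add: wf_program_def)
  moreover have "finite S" using touched_subset finite_domain by (rule finite_subset)
  ultimately have "finite ?W" and "card ?W \<le> (1 + card (fun_syms ?\<sigma>)) ^ locality_radius d m * card S"
    using assms(2) touched_nonempty by (simp_all add: finite_nbhd card_nbhd_le del: One_nat_def)
  then show "card (view P d R) \<le> (1 + card (fun_syms ?\<sigma>)) ^ locality_radius d m * card S"
    unfolding view_def using card_image_le le_trans by blast
qed

lemma two_power_card_le:
  assumes P: "depth_bounded_program (in_arity q) P d" "maintains P q" and un: "unary_schema (schema P)"
  shows "2 ^ card M \<le> (2 * card A) ^ ((1 + card (fun_syms (schema P)) + card (rel_syms (schema P))) *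
    ((1 + card (fun_syms (schema P))) ^ locality_radius d m * card S))"
proof -
  let ?F = "card (fun_syms (schema P))" and ?L = "card (rel_syms (schema P))"
  let ?w = "(1 + ?F) ^ locality_radius d m * card S"
  let ?U = "A \<times> (UNIV :: bool set) \<times> aux_types (schema P) A"
  let ?V = "{C. C \<subseteq> ?U \<and> C \<noteq> {} \<and> card C \<le> ?w}"
  have wf: "wf_program (in_arity q) P" using P(1) by (rule depth_bounded_program.wf_program)
  then have fin: "finite (fun_syms (schema P))" "finite (rel_syms (schema P))"
    by (simp_all add: wf_program_def)
  then have U: "finite ?U" using finite_domain by (simp add: finite_aux_types)
  have "1 \<le> card A"
    using touched_subset touched_nonempty finite_domain by (auto simp: Suc_le_eq card_gt_0_iff)
  then have card_U: "card ?U \<le> (2 * card A) ^ (1 + ?F + ?L)" by (rule card_labels_le[OF fin])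
  have inj: "inj_on (view P d) (Pow M)" by (rule inj_on_view[OF P un])
  have views: "view P d ` Pow M \<subseteq> ?V"
    by (intro image_subsetI CollectI conjI view_bounded[OF wf un] PowD)
  have "finite M" using inj_on_finite[OF inj views] finite_bounded_subsets[OF U] by simp
  then have "2 ^ card M = card (Pow M)" by (simp add: card_Pow)
  also have "\<dots> \<le> card ?U ^ ?w"
    using card_inj_on_le[OF inj views finite_bounded_subsets[OF U]]
      card_bounded_subsets_le[OF U] by (rule le_trans)
  also have "\<dots> \<le> ((2 * card A) ^ (1 + ?F + ?L)) ^ ?w" by (rule power_mono[OF card_U]) simp
  finally show ?thesis by (simp only: power_mult)
qed

end

lemma unary_DynQF_encoding_bound:
  fixes q :: "('i::finite, 'c::finite) query"
  assumes "q \<in> unary_DynQF"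
  shows "\<exists>C. \<forall>A S M G probe. probed_encoding q m A S M G probe \<longrightarrow>
    2 ^ card M \<le> (2 * card A) ^ (C * card S)"
proof -
  obtain P where wf: "wf_program (in_arity q) P" and un: "unary_schema (schema P)"
    and P: "maintains P q"
    using assms by (auto simp: unary_DynQF_def)
  obtain d where "depth_bounded_program (in_arity q) P d" using ex_depth_bounded_program[OF wf] by blast
  note bound = probed_encoding.two_power_card_le[OF _ this P un, unfolded mult.assoc[symmetric]]
  show ?thesis by (intro exI allI impI) (rule bound)
qed

section \<open>Reachability encodes quadratically many bits\<close>

text \<open>Node \<open>0\<close> is \<open>s\<close>, node \<open>1\<close> is \<open>t\<close>, and the \<open>n\<close> left, \<open>n\<close> right and \<open>n\<^sup>2\<close> middle nodes follow.\<close>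

definition middle_nodes :: "nat \<Rightarrow> nat set" where
  "middle_nodes n = {2 + 2 * n..<2 + 2 * n + n * n}"

definition left_node :: "nat \<Rightarrow> nat \<Rightarrow> nat" where
  "left_node n x = 2 + (x - (2 + 2 * n)) div n"

definition right_node :: "nat \<Rightarrow> nat \<Rightarrow> nat" where
  "right_node n x = 2 + n + (x - (2 + 2 * n)) mod n"

lemma left_node_bounds: "x \<in> middle_nodes n \<Longrightarrow> left_node n x \<in> {2..<2 + n}"
  by (auto simp: middle_nodes_def left_node_def less_mult_imp_div_less)

lemma right_node_bounds: "x \<in> middle_nodes n \<Longrightarrow> right_node n x \<in> {2 + n..<2 + 2 * n}"
  by (cases "n = 0") (auto simp: middle_nodes_def right_node_def)

lemma zero_not_middle_node: "0 \<notin> middle_nodes n"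
  by (simp add: middle_nodes_def)

lemma node_layers_disjoint:
  assumes "x \<in> middle_nodes n"
  shows "left_node n x \<noteq> 0" "right_node n x \<noteq> 0"
    and "left_node n x \<notin> middle_nodes n" "right_node n x \<notin> middle_nodes n"
    and "y \<in> middle_nodes n \<Longrightarrow> right_node n x \<noteq> left_node n y"
  using left_node_bounds[of _ n] right_node_bounds[OF assms] assms
  by (fastforce simp: middle_nodes_def)+

lemma middle_node_eqI:
  assumes "x \<in> middle_nodes n" "y \<in> middle_nodes n"
    and "left_node n x = left_node n y" "right_node n x = right_node n y"
  shows "x = y"
proof -
  have "x - (2 + 2 * n) = y - (2 + 2 * n)"
    using assms(3,4) div_mult_mod_eq unfolding left_node_def right_node_def
    by (metis add_left_cancel)
  then show ?thesis using assms(1,2) by (simp add: middle_nodes_def eq_diff_iff)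
qed

definition gadget :: "nat \<Rightarrow> nat set \<Rightarrow> (st_rel, st_const) database" where
  "gadget n R =
     \<lparr>dom = {..<2 + 2 * n + n * n},
      irel = (\<lambda>_. (\<lambda>x. [left_node n x, x]) ` middle_nodes n \<union> (\<lambda>x. [x, right_node n x]) ` R),
      const = (\<lambda>c. case c of st_const.s \<Rightarrow> 0 | st_const.t \<Rightarrow> 1)\<rparr>"

definition gadget_probe :: "nat \<Rightarrow> nat \<Rightarrow> (st_rel modification \<times> nat list) list" where
  "gadget_probe n x = [(Ins st_rel.E, [0, left_node n x]), (Ins st_rel.E, [right_node n x, 1])]"

lemma wf_gadget:
  assumes "R \<subseteq> middle_nodes n"
  shows "wf_database (\<lambda>_. 2) (gadget n R)"
proof -
  have "[left_node n x, x] \<in> nlists 2 {..<2 + 2 * n + n * n}"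
    "[x, right_node n x] \<in> nlists 2 {..<2 + 2 * n + n * n}" if "x \<in> middle_nodes n" for x
    using that left_node_bounds[OF that] right_node_bounds[OF that]
    by (auto simp: nlists_def middle_nodes_def)
  then show ?thesis
    using assms by (auto simp: wf_database_def gadget_def split: st_const.splits)
qed

lemma gadget_local:
  assumes "R \<inter> W = R' \<inter> W"
  shows "db_agree W (gadget n R) (gadget n R')"
  using assms by (auto simp: db_agree_def gadget_def)

definition probed_edges :: "nat \<Rightarrow> nat set \<Rightarrow> nat \<Rightarrow> nat rel" where
  "probed_edges n R x = {(0, left_node n x), (right_node n x, 1)} \<union>
     (\<lambda>y. (left_node n y, y)) ` middle_nodes n \<union> (\<lambda>y. (y, right_node n y)) ` R"

lemma reachable_in_probed_gadget:
  assumes R: "R \<subseteq> middle_nodes n" and x: "x \<in> middle_nodes n" "x \<notin> R"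
    and reach: "(0, v) \<in> (probed_edges n R x)\<^sup>*"
  shows "v \<in> {0, left_node n x} \<union> {y \<in> middle_nodes n. left_node n y = left_node n x} \<union>
    right_node n ` {y \<in> R. left_node n y = left_node n x}" (is "v \<in> ?I")
proof -
  have "w \<in> ?I" if u: "u \<in> ?I" and edge: "(u, w) \<in> probed_edges n R x" for u w
  proof -
    consider (source) "w = left_node n x" | (target) "u = right_node n x"
      | (left) "w \<in> middle_nodes n" "u = left_node n w" | (right) "u \<in> R" "w = right_node n u"
      using edge by (auto simp: probed_edges_def)
    then show ?thesis
    proof cases
      case target
      then have "u \<notin> {0, left_node n x} \<union> middle_nodes n"
        using x(1) by (simp add: node_layers_disjoint)
      then obtain y where y: "y \<in> R" "left_node n y = left_node n x" "u = right_node n y"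
        using u by blast
      then have "y = x" using R x(1) target by (auto intro: middle_node_eqI[of y n x])
      then show ?thesis using y x(2) by simp
    next
      case left
      then have "u \<notin> {0} \<union> middle_nodes n \<union> right_node n ` R"
        using R by (auto simp: node_layers_disjoint node_layers_disjoint(5)[symmetric])
      then have "left_node n w = left_node n x" using u left by auto
      then show ?thesis using left by simp
    next
      case right
      then have "u \<in> middle_nodes n" using R by blast
      then have "u \<notin> {0, left_node n x} \<union> right_node n ` R"
        using R x(1) zero_not_middle_node node_layers_disjoint by blast
      then have "left_node n u = left_node n x" using u by auto
      then show ?thesis using right by simp
    qed simp
  qed
  then have "probed_edges n R x `` ?I \<subseteq> ?I" by blast
  then have "(probed_edges n R x)\<^sup>* `` ?I = ?I" by (rule Image_closed_trancl)
  then show ?thesis using reach by blast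
qed

lemma probed_gadget_reachable_iff:
  assumes R: "R \<subseteq> middle_nodes n" and x: "x \<in> middle_nodes n"
  shows "(0, 1) \<in> (probed_edges n R x)\<^sup>* \<longleftrightarrow> x \<in> R"
proof
  assume "x \<in> R"
  then have "(0, left_node n x) \<in> probed_edges n R x" "(left_node n x, x) \<in> probed_edges n R x"
    "(x, right_node n x) \<in> probed_edges n R x" "(right_node n x, 1) \<in> probed_edges n R x"
    using x by (auto simp: probed_edges_def)
  then show "(0, 1) \<in> (probed_edges n R x)\<^sup>*"
    by (meson converse_rtrancl_into_rtrancl rtrancl.rtrancl_refl)
next
  assume reach: "(0, 1) \<in> (probed_edges n R x)\<^sup>*"
  have "1 \<notin> {0, left_node n x} \<union> middle_nodes n \<union> right_node n ` R"
    by (auto simp: middle_nodes_def left_node_def right_node_def)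
  then show "x \<in> R" using reachable_in_probed_gadget[OF R x _ reach] by blast
qed

lemma answer_probed_gadget:
  assumes "R \<subseteq> middle_nodes n" "x \<in> middle_nodes n"
  shows "[] \<in> answer st_reachability (fold modify (gadget_probe n x) (gadget n R)) \<longleftrightarrow> x \<in> R"
proof -
  let ?D = "fold modify (gadget_probe n x) (gadget n R)"
  have "{(u, v). [u, v] \<in> irel ?D st_rel.E} = probed_edges n R x"
    by (auto simp: gadget_probe_def gadget_def probed_edges_def)
  moreover have "const ?D st_const.s = 0" "const ?D st_const.t = 1"
    by (simp_all add: gadget_probe_def gadget_def)
  ultimately show ?thesis
    using probed_gadget_reachable_iff[OF assms] by (simp add: st_reachability_def)
qed

lemma probed_encoding_gadget:
  "probed_encoding st_reachability 2 {..<2 + 2 * n + n * n} {..<2 + 2 * n} (middle_nodes n)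
    (gadget n) (gadget_probe n)"
proof
  fix R assume "R \<subseteq> middle_nodes n"
  then show "wf_database (in_arity st_reachability) (gadget n R)"
    using wf_gadget by (simp add: st_reachability_def)
  show "dom (gadget n R) = {..<2 + 2 * n + n * n}" by (simp add: gadget_def)
  show "range (const (gadget n R)) \<subseteq> {..<2 + 2 * n}"
    by (auto simp: gadget_def split: st_const.splits)
next
  fix x assume x: "x \<in> middle_nodes n"
  show "\<forall>\<mu> \<in> set (gadget_probe n x).
      valid_modification (in_arity st_reachability) {..<2 + 2 * n} \<mu>"
    using left_node_bounds[OF x] right_node_bounds[OF x]
    by (simp add: gadget_probe_def valid_modification_def nlists_def st_reachability_def)
  show "length (gadget_probe n x) = 2" by (simp add: gadget_probe_def)
qed (simp_all add: gadget_local answer_probed_gadget, simp add: st_reachability_def)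

lemma ex_power_less_pow_square:
  "\<exists>n. (2 * (2 + 2 * n + n * n)) ^ (C * (2 + 2 * n)) < (2 :: nat) ^ (n * n)"
proof -
  let ?N = "\<lambda>n. 2 * (2 + 2 * n + n * n) :: nat"
  have "(\<lambda>n. (2 + 2 * real n) * ln (real (?N n)) / (real n * real n)) \<longlonglongrightarrow> 0"
    by real_asymp
  then have "(\<lambda>n. real C * ((2 + 2 * real n) * ln (real (?N n)) / (real n * real n))) \<longlonglongrightarrow> real C * 0"
    by (rule tendsto_mult_left)
  then have "\<forall>\<^sub>F n in sequentially.
      real C * ((2 + 2 * real n) * ln (real (?N n)) / (real n * real n)) < ln 2"
    by (rule order_tendstoD) simp
  then have "\<forall>\<^sub>F n in sequentially. 0 < n \<and>
      real C * ((2 + 2 * real n) * ln (real (?N n)) / (real n * real n)) < ln 2"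
    using eventually_gt_at_top by (rule eventually_conj[rotated])
  then obtain n where "0 < n"
    and "real C * ((2 + 2 * real n) * ln (real (?N n)) / (real n * real n)) < ln 2"
    using eventually_happens'[OF sequentially_bot] by blast
  then have "real (C * (2 + 2 * n)) * ln (real (?N n)) < real (n * n) * ln 2"
    by (simp add: field_simps)
  then have "ln (real (?N n) ^ (C * (2 + 2 * n))) < ln (2 ^ (n * n))"
    by (simp add: ln_realpow del: of_nat_mult of_nat_add)
  moreover have "0 < real (?N n)" unfolding of_nat_0_less_iff by simp
  ultimately have "real (?N n) ^ (C * (2 + 2 * n)) < 2 ^ (n * n)"
    by (simp only: ln_less_cancel_iff zero_less_power zero_less_numeral)
  then have "real (?N n ^ (C * (2 + 2 * n))) < real (2 ^ (n * n))"
    by (simp only: of_nat_power of_nat_numeral)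
  then have "?N n ^ (C * (2 + 2 * n)) < 2 ^ (n * n)" by (simp only: of_nat_less_iff)
  then show ?thesis by blast
qed

theorem theorem5p7: "st_reachability \<notin> unary_DynQF"
proof
  assume "st_reachability \<in> unary_DynQF"
  then obtain C where bound: "\<forall>A S M G probe. probed_encoding st_reachability 2 A S M G probe \<longrightarrow>
      2 ^ card M \<le> (2 * card A) ^ (C * card S)"
    using unary_DynQF_encoding_bound by blast
  have "2 ^ (n * n) \<le> (2 * (2 + 2 * n + n * n)) ^ (C * (2 + 2 * n))" for n
    using bound probed_encoding_gadget[of n] by (fastforce simp: middle_nodes_def)
  then show False using ex_power_less_pow_square[of C] by (simp add: leD)
qed

end
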